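(* Let $\xi_1,\xi_2,\ldots$ be a swap-invariant sequence of (integrable, not almost surely zero) random variables, and let $X$ be the almost sure limit of $n^{-1}(\xi_1+\cdots+\xi_n)$ as $n\to\infty$ (which exists for every swap-invariant sequence and is integrable). Assume that one of the following conditions holds: (a) $\xi_k\neq 0$ almost surely for some $k\ge 1$; (b) the sequence $\xi_1,\xi_2,\ldots$ is uniformly integrable. Then the convergence $n^{-1}(\xi_1+\cdots+\xi_n)\to X$ also holds in $L^1$.
   Context: Two integrable random vectors $\xi,\xi^*$ in $\mathbb{R}^d$ are zonoid equivalent if $\mathbf{E}|\langle u,\xi\rangle|=\mathbf{E}|\langle u,\xi^*\rangle|$ for all $u\in\mathbb{R}^d$. An integrable random vector is called swap-invariant if all random vectors obtained by permutations of its coordinates are zonoid equivalent. A sequence of integrable random variables is called swap-invariant if all its finite subsequences are swap-invariant (as random vectors). *)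

theory Defs
  imports "HOL-Probability.Probability" "HOL-Combinatorics.Permutations"
begin

text \<open>
  The dimension has to vary inside the definition of swap-invariance of a sequence, so a random
  vector in \<open>d\<close>-dimensional space is given by its coordinates \<open>X 0, \<dots>, X (d - 1)\<close>,
  the values \<open>X i\<close> for \<open>i \<ge> d\<close> being irrelevant.
\<close>

definition integrable_vector :: "nat \<Rightarrow> 'a measure \<Rightarrow> (nat \<Rightarrow> 'a \<Rightarrow> real) \<Rightarrow> bool" where
  "integrable_vector d M X \<longleftrightarrow> (\<forall>i<d. integrable M (X i))"

definition zonoid_equivalent ::
    "nat \<Rightarrow> 'a measure \<Rightarrow> (nat \<Rightarrow> 'a \<Rightarrow> real) \<Rightarrow> 'b measure \<Rightarrow> (nat \<Rightarrow> 'b \<Rightarrow> real) \<Rightarrow> bool" where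
  "zonoid_equivalent d M X N Y \<longleftrightarrow>
     integrable_vector d M X \<and> integrable_vector d N Y \<and>
     (\<forall>u :: nat \<Rightarrow> real.
        (LINT \<omega>|M. \<bar>\<Sum>i<d. u i * X i \<omega>\<bar>) = (LINT \<omega>|N. \<bar>\<Sum>i<d. u i * Y i \<omega>\<bar>))"

definition swap_invariant_vector :: "nat \<Rightarrow> 'a measure \<Rightarrow> (nat \<Rightarrow> 'a \<Rightarrow> real) \<Rightarrow> bool" where
  "swap_invariant_vector d M X \<longleftrightarrow>
     integrable_vector d M X \<and>
     (\<forall>p q. p permutes {..<d} \<longrightarrow> q permutes {..<d} \<longrightarrow>
        zonoid_equivalent d M (\<lambda>i. X (p i)) M (\<lambda>i. X (q i)))"

definition swap_invariant :: "'a measure \<Rightarrow> (nat \<Rightarrow> 'a \<Rightarrow> real) \<Rightarrow> bool" where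
  "swap_invariant M \<xi> \<longleftrightarrow>
     (\<forall>i. integrable M (\<xi> i)) \<and>
     (\<forall>d (s :: nat \<Rightarrow> nat). strict_mono_on {..<d} s \<longrightarrow>
        swap_invariant_vector d M (\<lambda>i. \<xi> (s i)))"

text \<open>The supremum is taken in \<open>ennreal\<close>, so that it is meaningful without a boundedness assumption.\<close>

definition uniformly_integrable :: "'a measure \<Rightarrow> (nat \<Rightarrow> 'a \<Rightarrow> real) \<Rightarrow> bool" where
  "uniformly_integrable M \<xi> \<longleftrightarrow>
     (\<forall>k. \<xi> k \<in> borel_measurable M) \<and>
     ((\<lambda>a :: real. SUP k. \<integral>\<^sup>+\<omega>. ennreal \<bar>\<xi> k \<omega>\<bar> * indicator {\<omega>. a < \<bar>\<xi> k \<omega>\<bar>} \<omega> \<partial>M)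
        \<longlongrightarrow> 0) at_top"

text \<open>
  Integrability is part of the notion: the Bochner integral of a non-integrable function is \<open>0\<close>.
\<close>

definition converges_in_L1 :: "'a measure \<Rightarrow> (nat \<Rightarrow> 'a \<Rightarrow> real) \<Rightarrow> ('a \<Rightarrow> real) \<Rightarrow> bool" where
  "converges_in_L1 M Y X \<longleftrightarrow>
     (\<forall>n. integrable M (Y n)) \<and> integrable M X \<and>
     (\<lambda>n. LINT \<omega>|M. \<bar>Y n \<omega> - X \<omega>\<bar>) \<longlonglongrightarrow> 0"

end

theory Submission
  imports Defs
begin

text \<open>
  Almost sure convergence improves to convergence in \<open>L\<^sup>1\<close> as soon as, for every \<open>\<epsilon> > 0\<close>,
  there is an integrable \<open>g \<ge> 0\<close> with \<open>\<^bold>E (\<bar>\<xi>\<^sub>i\<bar> - g)\<^sup>+ \<le> \<epsilon>\<close> for all \<open>i\<close>; by convexity this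
  property passes to averages. Uniform integrability provides a constant \<open>g\<close>. If \<open>\<xi>\<^sub>k \<noteq> 0\<close> almost
  surely, take \<open>g = a \<bar>\<xi>\<^sub>k\<bar>\<close>: since
  \<open>(\<bar>x\<bar> - a \<bar>w\<bar>)\<^sup>+ = (\<bar>x + a w\<bar> + \<bar>x - a w\<bar>) / 2 - a \<bar>w\<bar>\<close>,
  swap-invariance shows that \<open>\<^bold>E (\<bar>\<xi>\<^sub>i\<bar> - a \<bar>\<xi>\<^sub>k\<bar>)\<^sup>+\<close> is the same for all \<open>i \<noteq> k\<close>, and it tends
  to \<open>0\<close> as \<open>a\<close> tends to infinity.
\<close>

text \<open>Clamping all values to \<open>[- g, g]\<close> leaves a part dominated by a multiple of
  \<open>g\<close>, so that dominated convergence applies. What is cut off has integral at most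
  \<open>\<epsilon>\<close>, and Fatou's lemma carries this bound over to the limit.\<close>

lemma converges_in_L1_if_uniform_excess:
  fixes Y :: "nat \<Rightarrow> 'a \<Rightarrow> real" and X :: "'a \<Rightarrow> real"
  assumes Y: "\<And>n. integrable M (Y n)" and X: "X \<in> borel_measurable M"
    and lim: "AE \<omega> in M. (\<lambda>n. Y n \<omega>) \<longlonglongrightarrow> X \<omega>"
    and excess: "\<And>\<epsilon>. \<epsilon> > 0 \<Longrightarrow> \<exists>g. integrable M g \<and> (\<forall>\<omega>. 0 \<le> g \<omega>) \<and>
        (\<forall>n. (LINT \<omega>|M. max 0 (\<bar>Y n \<omega>\<bar> - g \<omega>)) \<le> \<epsilon>)"
  shows "converges_in_L1 M Y X"
proof -
  have [measurable]: "Y n \<in> borel_measurable M" "X \<in> borel_measurable M" for n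
    using Y X by auto
  \<comment> \<open>Of the three \<open>\<epsilon>\<close>, two pay for the excesses of
    \<open>Y n\<close> and \<open>X\<close>, one for the clamped difference. Integrability of
    \<open>X\<close> is included because it comes out of the same Fatou estimate.\<close>
  have key: "integrable M X \<and> (\<forall>\<^sub>F n in sequentially. (LINT \<omega>|M. \<bar>Y n \<omega> - X \<omega>\<bar>) < 3 * \<epsilon>)"
    if "\<epsilon> > 0" for \<epsilon>
  proof -
    obtain g where g: "integrable M g" and g0: "\<And>\<omega>. 0 \<le> g \<omega>"
      and gY: "\<And>n. (LINT \<omega>|M. max 0 (\<bar>Y n \<omega>\<bar> - g \<omega>)) \<le> \<epsilon>"
      using excess[OF \<open>\<epsilon> > 0\<close>] by blast
    have [measurable]: "g \<in> borel_measurable M" using g by auto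
    define h where "h = (\<lambda>x \<omega>. max 0 (\<bar>x\<bar> - g \<omega>))"
    define T where "T = (\<lambda>x \<omega>. max (- g \<omega>) (min (g \<omega>) x))"
    have intY: "integrable M (\<lambda>\<omega>. h (Y n \<omega>) \<omega>)" for n
      unfolding h_def using Y g by auto
    \<comment> \<open>Fatou's lemma is applied to nonnegative integrals, since integrability of the
      excess of \<open>X\<close> is not yet known. Continuity of the excess in its first argument
      turns the pointwise limit into a liminf.\<close>
    have "(\<integral>\<^sup>+\<omega>. ennreal (h (X \<omega>) \<omega>) \<partial>M)
        = (\<integral>\<^sup>+\<omega>. liminf (\<lambda>n. ennreal (h (Y n \<omega>) \<omega>)) \<partial>M)"
    proof (rule nn_integral_cong_AE, use lim in eventually_elim)
      case (elim \<omega>)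
      then have "(\<lambda>n. ennreal (h (Y n \<omega>) \<omega>)) \<longlonglongrightarrow> ennreal (h (X \<omega>) \<omega>)"
        unfolding h_def by (intro tendsto_intros)
      then show ?case
        by (simp add: lim_imp_Liminf)
    qed
    also have "\<dots> \<le> liminf (\<lambda>n. \<integral>\<^sup>+\<omega>. ennreal (h (Y n \<omega>) \<omega>) \<partial>M)"
      by (rule nn_integral_liminf) (simp add: h_def)
    also have "\<dots> \<le> liminf (\<lambda>n::nat. ennreal \<epsilon>)"
    proof (rule Liminf_mono, rule always_eventually, rule allI)
      fix n
      have "(\<integral>\<^sup>+\<omega>. ennreal (h (Y n \<omega>) \<omega>) \<partial>M) = ennreal (LINT \<omega>|M. h (Y n \<omega>) \<omega>)"
        by (rule nn_integral_eq_integral[OF intY]) (simp add: h_def)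
      also have "\<dots> \<le> ennreal \<epsilon>"
        using gY[of n] by (intro ennreal_leI) (simp add: h_def)
      finally show "(\<integral>\<^sup>+\<omega>. ennreal (h (Y n \<omega>) \<omega>) \<partial>M) \<le> ennreal \<epsilon>" .
    qed
    finally have fatou: "(\<integral>\<^sup>+\<omega>. ennreal (h (X \<omega>) \<omega>) \<partial>M) \<le> ennreal \<epsilon>"
      by (simp add: Liminf_const)
    have intX: "integrable M (\<lambda>\<omega>. h (X \<omega>) \<omega>)"
      using fatou by (intro integrableI_nonneg) (auto simp: h_def intro: le_less_trans)
    have hX: "(LINT \<omega>|M. h (X \<omega>) \<omega>) \<le> \<epsilon>"
      using fatou nn_integral_eq_integral[OF intX] \<open>\<epsilon> > 0\<close> by (auto simp: h_def)
    \<comment> \<open>The bound is \<open>\<bar>X \<omega>\<bar> \<le> h (X \<omega>) \<omega> + g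
      \<omega>\<close>.\<close>
    have X_int: "integrable M X"
      by (rule Bochner_Integration.integrable_bound[OF Bochner_Integration.integrable_add[OF intX g]])
        (auto simp: h_def)
    have T_lim: "(\<lambda>n. LINT \<omega>|M. \<bar>T (Y n \<omega>) \<omega> - T (X \<omega>) \<omega>\<bar>) \<longlonglongrightarrow> (LINT \<omega>|M. 0)"
    proof (rule integral_dominated_convergence[where w = "\<lambda>\<omega>. 2 * g \<omega>"])
      show "AE \<omega> in M. (\<lambda>n. \<bar>T (Y n \<omega>) \<omega> - T (X \<omega>) \<omega>\<bar>) \<longlonglongrightarrow> 0"
        using lim
      proof eventually_elim
        case (elim \<omega>)
        then have "(\<lambda>n. \<bar>T (Y n \<omega>) \<omega> - T (X \<omega>) \<omega>\<bar>) \<longlonglongrightarrow> \<bar>T (X \<omega>) \<omega> - T (X \<omega>) \<omega>\<bar>"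
          unfolding T_def by (intro tendsto_intros)
        then show ?case by simp
      qed
      show "AE \<omega> in M. norm \<bar>T (Y n \<omega>) \<omega> - T (X \<omega>) \<omega>\<bar> \<le> 2 * g \<omega>" for n
      proof (rule AE_I2)
        fix \<omega>
        show "norm \<bar>T (Y n \<omega>) \<omega> - T (X \<omega>) \<omega>\<bar> \<le> 2 * g \<omega>"
          using g0[of \<omega>] unfolding T_def by auto
      qed
    qed (use g in \<open>auto simp: T_def\<close>)
    have T_int: "integrable M (\<lambda>\<omega>. \<bar>T (Y n \<omega>) \<omega> - T (X \<omega>) \<omega>\<bar>)" for n
      unfolding T_def using Y X_int g by auto
    have "(LINT \<omega>|M. \<bar>Y n \<omega> - X \<omega>\<bar>)
        \<le> 2 * \<epsilon> + (LINT \<omega>|M. \<bar>T (Y n \<omega>) \<omega> - T (X \<omega>) \<omega>\<bar>)" for n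
    proof -
      have "(LINT \<omega>|M. \<bar>Y n \<omega> - X \<omega>\<bar>)
          \<le> (LINT \<omega>|M. (h (Y n \<omega>) \<omega> + h (X \<omega>) \<omega>) + \<bar>T (Y n \<omega>) \<omega> - T (X \<omega>) \<omega>\<bar>)"
      proof (rule integral_mono)
        \<comment> \<open>Clamping moves a point by exactly its excess, so the triangle inequality
          through the two clamped values gives the estimate.\<close>
        have "\<bar>x - T x \<omega>\<bar> = h x \<omega>" for x \<omega>
          using g0[of \<omega>] unfolding h_def T_def by (auto simp: max_def min_def abs_if)
        from this[of "Y n _"] this[of "X _"]
        show "\<bar>Y n \<omega> - X \<omega>\<bar> \<le> (h (Y n \<omega>) \<omega> + h (X \<omega>) \<omega>) + \<bar>T (Y n \<omega>) \<omega> - T (X \<omega>) \<omega>\<bar>" for \<omega>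
          by (smt (verit))
      qed (use Y X_int intX intY T_int in auto)
      also have "\<dots> = (LINT \<omega>|M. h (Y n \<omega>) \<omega>) + (LINT \<omega>|M. h (X \<omega>) \<omega>)
          + (LINT \<omega>|M. \<bar>T (Y n \<omega>) \<omega> - T (X \<omega>) \<omega>\<bar>)"
        using intX intY T_int by simp
      finally show ?thesis
        using gY[of n] hX by (simp add: h_def)
    qed
    moreover have "\<forall>\<^sub>F n in sequentially. (LINT \<omega>|M. \<bar>T (Y n \<omega>) \<omega> - T (X \<omega>) \<omega>\<bar>) < \<epsilon>"
      using order_tendstoD(2)[OF T_lim, of \<epsilon>] \<open>\<epsilon> > 0\<close> by simp
    ultimately have "\<forall>\<^sub>F n in sequentially. (LINT \<omega>|M. \<bar>Y n \<omega> - X \<omega>\<bar>) < 3 * \<epsilon>"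
      by (smt (verit, best) eventually_mono)
    with X_int show ?thesis by blast
  qed
  have "(\<lambda>n. LINT \<omega>|M. \<bar>Y n \<omega> - X \<omega>\<bar>) \<longlonglongrightarrow> 0"
  proof (rule order_tendstoI)
    fix e :: real assume "0 < e"
    then show "\<forall>\<^sub>F n in sequentially. (LINT \<omega>|M. \<bar>Y n \<omega> - X \<omega>\<bar>) < e"
      using key[of "e / 3"] by simp
  next
    fix e :: real assume "e < 0"
    then have "e < (LINT \<omega>|M. \<bar>Y n \<omega> - X \<omega>\<bar>)" for n
      by (rule less_le_trans) simp
    then show "\<forall>\<^sub>F n in sequentially. e < (LINT \<omega>|M. \<bar>Y n \<omega> - X \<omega>\<bar>)"
      by simp
  qed
  then show ?thesis
    using Y key[of 1] by (simp add: converges_in_L1_def)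
qed

text \<open>For a fixed level the excess is a convex function of the value, so the excess of an
  average is at most the average of the excesses.\<close>

lemma average_excess_le:
  fixes \<xi> :: "nat \<Rightarrow> 'a \<Rightarrow> real"
  assumes \<xi>: "\<And>i. integrable M (\<xi> i)" and g: "integrable M g" "\<And>\<omega>. 0 \<le> g \<omega>"
    and le: "\<And>i. (LINT \<omega>|M. max 0 (\<bar>\<xi> i \<omega>\<bar> - g \<omega>)) \<le> \<epsilon>" and "0 \<le> \<epsilon>"
  shows "(LINT \<omega>|M. max 0 (\<bar>(\<Sum>i<n. \<xi> i \<omega>) / real n\<bar> - g \<omega>)) \<le> \<epsilon>"
proof (cases "n = 0")
  \<comment> \<open>The empty average is \<open>0 / 0 = 0\<close>, whose excess over
    \<open>g \<ge> 0\<close> vanishes.\<close>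
  case True
  then show ?thesis using g \<open>0 \<le> \<epsilon>\<close> by (simp add: max_absorb1)
next
  case False
  have int: "integrable M (\<lambda>\<omega>. max 0 (\<bar>\<xi> i \<omega>\<bar> - g \<omega>))" for i
    using \<xi> g by auto
  have "(LINT \<omega>|M. max 0 (\<bar>(\<Sum>i<n. \<xi> i \<omega>) / real n\<bar> - g \<omega>))
      \<le> (LINT \<omega>|M. (\<Sum>i<n. max 0 (\<bar>\<xi> i \<omega>\<bar> - g \<omega>)) / real n)"
  proof (rule integral_mono)
    fix \<omega>
    have "\<bar>\<Sum>i<n. \<xi> i \<omega>\<bar> \<le> (\<Sum>i<n. \<bar>\<xi> i \<omega>\<bar>)"
      by (rule sum_abs)
    also have "\<dots> \<le> (\<Sum>i<n. max 0 (\<bar>\<xi> i \<omega>\<bar> - g \<omega>) + g \<omega>)"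
      by (rule sum_mono) auto
    also have "\<dots> = (\<Sum>i<n. max 0 (\<bar>\<xi> i \<omega>\<bar> - g \<omega>)) + real n * g \<omega>"
      by (simp add: sum.distrib)
    finally have "\<bar>\<Sum>i<n. \<xi> i \<omega>\<bar> / real n
        \<le> ((\<Sum>i<n. max 0 (\<bar>\<xi> i \<omega>\<bar> - g \<omega>)) + real n * g \<omega>) / real n"
      by (rule divide_right_mono) simp
    then have "\<bar>(\<Sum>i<n. \<xi> i \<omega>) / real n\<bar> - g \<omega> \<le> (\<Sum>i<n. max 0 (\<bar>\<xi> i \<omega>\<bar> - g \<omega>)) / real n"
      using False by (simp add: add_divide_distrib)
    moreover have "0 \<le> (\<Sum>i<n. max 0 (\<bar>\<xi> i \<omega>\<bar> - g \<omega>)) / real n"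
      by (simp add: sum_nonneg)
    ultimately show "max 0 (\<bar>(\<Sum>i<n. \<xi> i \<omega>) / real n\<bar> - g \<omega>)
        \<le> (\<Sum>i<n. max 0 (\<bar>\<xi> i \<omega>\<bar> - g \<omega>)) / real n"
      by simp
  qed (use \<xi> g int in auto)
  also have "\<dots> = (\<Sum>i<n. LINT \<omega>|M. max 0 (\<bar>\<xi> i \<omega>\<bar> - g \<omega>)) / real n"
    using int by simp
  also have "\<dots> \<le> (\<Sum>i<n. \<epsilon>) / real n"
    by (intro divide_right_mono sum_mono le) simp
  finally show ?thesis using False by simp
qed

lemma uniformly_integrable_excess:
  assumes "prob_space M" and \<xi>: "\<And>i. integrable M (\<xi> i)"
    and ui: "uniformly_integrable M \<xi>" and "0 < \<epsilon>"
  shows "\<exists>g. integrable M g \<and> (\<forall>\<omega>. 0 \<le> g \<omega>) \<and>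
    (\<forall>i. (LINT \<omega>|M. max 0 (\<bar>\<xi> i \<omega>\<bar> - g \<omega>)) \<le> \<epsilon>)"
proof -
  interpret prob_space M by fact
  let ?S = "\<lambda>a :: real. SUP k. \<integral>\<^sup>+\<omega>. ennreal \<bar>\<xi> k \<omega>\<bar> * indicator {\<omega>. a < \<bar>\<xi> k \<omega>\<bar>} \<omega> \<partial>M"
  have "(?S \<longlongrightarrow> 0) at_top"
    using ui by (simp add: uniformly_integrable_def)
  then have "\<forall>\<^sub>F a in at_top. ?S a < ennreal \<epsilon>"
    by (rule order_tendstoD) (simp add: \<open>0 < \<epsilon>\<close>)
  \<comment> \<open>The level is taken nonnegative so that the constant \<open>a\<close> can serve
    as \<open>g\<close> and the excess over \<open>a\<close> never exceeds the value itself.\<close>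
  then obtain a where a: "0 \<le> a" "?S a < ennreal \<epsilon>"
    using eventually_conj[OF eventually_ge_at_top[of 0]] eventually_happens[of _ at_top]
    by (metis (no_types, lifting) trivial_limit_at_top_linorder)
  have "(LINT \<omega>|M. max 0 (\<bar>\<xi> i \<omega>\<bar> - a)) \<le> \<epsilon>" for i
  proof -
    have "ennreal (LINT \<omega>|M. max 0 (\<bar>\<xi> i \<omega>\<bar> - a)) = (\<integral>\<^sup>+\<omega>. ennreal (max 0 (\<bar>\<xi> i \<omega>\<bar> - a)) \<partial>M)"
      using \<xi> by (intro nn_integral_eq_integral[symmetric]) auto
    also have "\<dots> \<le> (\<integral>\<^sup>+\<omega>. ennreal \<bar>\<xi> i \<omega>\<bar> * indicator {\<omega>. a < \<bar>\<xi> i \<omega>\<bar>} \<omega> \<partial>M)"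
      using a(1) by (intro nn_integral_mono) (auto simp: indicator_def ennreal_neg intro!: ennreal_leI)
    also have "\<dots> \<le> ?S a"
      by (rule SUP_upper) simp
    finally show ?thesis
      using a(2) \<open>0 < \<epsilon>\<close> by (simp add: ennreal_le_iff[symmetric] del: ennreal_le_iff)
  qed
  then show ?thesis
    using a(1) by (intro exI[of _ "\<lambda>_. a"]) simp
qed

text \<open>The transposition of \<open>i\<close> and \<open>j\<close> fixes \<open>k\<close>, so it
  turns one linear combination into the other.\<close>

lemma swap_invariant_pair:
  assumes si: "swap_invariant M \<xi>" and "i \<noteq> k" "j \<noteq> k"
  shows "(LINT \<omega>|M. \<bar>\<xi> i \<omega> + b * \<xi> k \<omega>\<bar>) = (LINT \<omega>|M. \<bar>\<xi> j \<omega> + b * \<xi> k \<omega>\<bar>)"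
proof -
  define d where "d = Suc (max k (max i j))"
  have d: "k < d" "i < d" "j < d" by (auto simp: d_def)
  \<comment> \<open>The direction \<open>u\<close> picks out coordinates \<open>i\<close> and
    \<open>k\<close> of an initial segment long enough to contain all three indices.\<close>
  define u where "u = (\<lambda>l. (if l = i then 1 else 0) + (if l = k then b else 0) :: real)"
  have *: "(\<Sum>l<d. u l * f l) = f i + b * f k" for f :: "nat \<Rightarrow> real"
    using d by (simp add: u_def distrib_right sum.distrib if_distrib[of "\<lambda>x. x * _"] cong: if_cong)
  have "swap_invariant_vector d M \<xi>"
    using si unfolding swap_invariant_def by (elim conjE allE[of _ d] allE[of _ id]) (simp add: strict_mono_on_def)
  then have "zonoid_equivalent d M (\<lambda>l. \<xi> (id l)) M (\<lambda>l. \<xi> (Transposition.transpose i j l))"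
    using d permutes_id[of "{..<d}"] permutes_swap_id[of i "{..<d}" j]
    unfolding swap_invariant_vector_def by fastforce
  then have "(LINT \<omega>|M. \<bar>\<Sum>l<d. u l * \<xi> (id l) \<omega>\<bar>)
      = (LINT \<omega>|M. \<bar>\<Sum>l<d. u l * \<xi> (Transposition.transpose i j l) \<omega>\<bar>)"
    unfolding zonoid_equivalent_def by blast
  then show ?thesis
    unfolding * using assms(2,3) by (simp add: transpose_apply_other)
qed

lemma swap_invariant_excess_eq:
  fixes a :: real
  assumes si: "swap_invariant M \<xi>" and "i \<noteq> k" "j \<noteq> k" and "0 \<le> a"
  shows "(LINT \<omega>|M. max 0 (\<bar>\<xi> i \<omega>\<bar> - a * \<bar>\<xi> k \<omega>\<bar>)) = (LINT \<omega>|M. max 0 (\<bar>\<xi> j \<omega>\<bar> - a * \<bar>\<xi> k \<omega>\<bar>))"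
proof -
  have int: "integrable M (\<xi> l)" for l
    using si by (simp add: swap_invariant_def)
  \<comment> \<open>The mean of \<open>\<bar>x + v\<bar>\<close> and
    \<open>\<bar>x - v\<bar>\<close> is the larger of \<open>\<bar>x\<bar>\<close> and
    \<open>\<bar>v\<bar>\<close>. The difference is written with the coefficient \<open>- a\<close>
    so that \<open>swap_invariant_pair\<close> applies to both terms.\<close>
  have split: "max 0 (\<bar>x\<bar> - a * \<bar>w\<bar>) = (\<bar>x + a * w\<bar> + \<bar>x + (- a) * w\<bar>) / 2 - a * \<bar>w\<bar>" for x w :: real
  proof -
    have "max 0 (\<bar>x\<bar> - \<bar>v\<bar>) = (\<bar>x + v\<bar> + \<bar>x - v\<bar>) / 2 - \<bar>v\<bar>" for v
      by (auto simp: max_def abs_if)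
    from this[of "a * w"] show ?thesis
      using \<open>0 \<le> a\<close> by (simp add: abs_mult)
  qed
  have "(LINT \<omega>|M. max 0 (\<bar>\<xi> l \<omega>\<bar> - a * \<bar>\<xi> k \<omega>\<bar>))
      = ((LINT \<omega>|M. \<bar>\<xi> l \<omega> + a * \<xi> k \<omega>\<bar>) + (LINT \<omega>|M. \<bar>\<xi> l \<omega> + (- a) * \<xi> k \<omega>\<bar>)) / 2
        - a * (LINT \<omega>|M. \<bar>\<xi> k \<omega>\<bar>)" for l
    unfolding split using int by simp
  from this[of i] this[of j] show ?thesis
    unfolding swap_invariant_pair[OF assms(1-3)] by simp
qed

lemma swap_invariant_excess:
  assumes si: "swap_invariant M \<xi>" and nz: "AE \<omega> in M. \<xi> k \<omega> \<noteq> 0" and "0 < \<epsilon>"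
  shows "\<exists>g. integrable M g \<and> (\<forall>\<omega>. 0 \<le> g \<omega>) \<and>
    (\<forall>i. (LINT \<omega>|M. max 0 (\<bar>\<xi> i \<omega>\<bar> - g \<omega>)) \<le> \<epsilon>)"
proof -
  have int: "integrable M (\<xi> l)" for l
    using si by (simp add: swap_invariant_def)
  then have [measurable]: "\<xi> l \<in> borel_measurable M" for l
    by auto
  \<comment> \<open>\<open>Suc k\<close> is just an index other than \<open>k\<close>: a multiple
    \<open>n\<close> that works for it works for every \<open>i \<noteq> k\<close>.\<close>
  let ?E = "\<lambda>i (n::nat). LINT \<omega>|M. max 0 (\<bar>\<xi> i \<omega>\<bar> - real n * \<bar>\<xi> k \<omega>\<bar>)"
  have "?E (Suc k) \<longlonglongrightarrow> (LINT \<omega>|M. 0)"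
  proof (rule integral_dominated_convergence[where w = "\<lambda>\<omega>. \<bar>\<xi> (Suc k) \<omega>\<bar>"])
    show "AE \<omega> in M. (\<lambda>n. max 0 (\<bar>\<xi> (Suc k) \<omega>\<bar> - real n * \<bar>\<xi> k \<omega>\<bar>)) \<longlonglongrightarrow> 0"
      using nz
    proof eventually_elim
      case (elim \<omega>)
      obtain m where m: "\<bar>\<xi> (Suc k) \<omega>\<bar> < real m * \<bar>\<xi> k \<omega>\<bar>"
        using reals_Archimedean3[of "\<bar>\<xi> k \<omega>\<bar>"] elim by auto
      \<comment> \<open>Because \<open>\<xi> k \<omega>\<close> is nonzero, the excess is not only
        small but zero from some \<open>m\<close> on.\<close>
      have "max 0 (\<bar>\<xi> (Suc k) \<omega>\<bar> - real n * \<bar>\<xi> k \<omega>\<bar>) = 0" if "m \<le> n" for n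
        using m mult_right_mono[of "real m" "real n" "\<bar>\<xi> k \<omega>\<bar>"] that by simp
      then show ?case
        by (intro tendsto_eventually eventually_sequentiallyI)
    qed
  qed (use int in auto)
  then have "\<forall>\<^sub>F n in sequentially. ?E (Suc k) n < \<epsilon>"
    using order_tendstoD(2)[of "?E (Suc k)" 0 _ \<epsilon>] \<open>0 < \<epsilon>\<close> by simp
  \<comment> \<open>Requiring \<open>1 \<le> n\<close> makes the excess vanish in the remaining case
    \<open>i = k\<close>.\<close>
  then obtain n where n: "1 \<le> n" "?E (Suc k) n < \<epsilon>"
    using eventually_conj[OF eventually_ge_at_top[of 1]] eventually_happens[of _ sequentially]
    by (metis (no_types, lifting) trivial_limit_sequentially)
  have "?E i n \<le> \<epsilon>" for i
  proof (cases "i = k")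
    case True
    have "max 0 (\<bar>\<xi> k \<omega>\<bar> - real n * \<bar>\<xi> k \<omega>\<bar>) = 0" for \<omega>
      using n(1) mult_right_mono[of 1 "real n" "\<bar>\<xi> k \<omega>\<bar>"] by simp
    with True show ?thesis using \<open>0 < \<epsilon>\<close> by simp
  next
    case False
    then show ?thesis
      using swap_invariant_excess_eq[OF si, of i k "Suc k" "real n"] n(2) by simp
  qed
  then show ?thesis
    using int by (intro exI[of _ "\<lambda>\<omega>. real n * \<bar>\<xi> k \<omega>\<bar>"]) auto
qed

theorem theorem19:
  fixes M :: "'a measure" and \<xi> :: "nat \<Rightarrow> 'a \<Rightarrow> real" and X :: "'a \<Rightarrow> real"
  assumes "prob_space M"
    and "swap_invariant M \<xi>"
    and "\<And>k. \<not> (AE \<omega> in M. \<xi> k \<omega> = 0)"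
    and "X \<in> borel_measurable M"
    and "AE \<omega> in M. (\<lambda>n. (\<Sum>i<n. \<xi> i \<omega>) / real n) \<longlonglongrightarrow> X \<omega>"
    and "(\<exists>k. AE \<omega> in M. \<xi> k \<omega> \<noteq> 0) \<or> uniformly_integrable M \<xi>"
  shows "converges_in_L1 M (\<lambda>n \<omega>. (\<Sum>i<n. \<xi> i \<omega>) / real n) X"
proof -
  have int: "integrable M (\<xi> i)" for i
    using assms(2) by (simp add: swap_invariant_def)
  show ?thesis
  proof (rule converges_in_L1_if_uniform_excess)
    fix \<epsilon> :: real assume "0 < \<epsilon>"
    have "\<exists>g. integrable M g \<and> (\<forall>\<omega>. 0 \<le> g \<omega>) \<and>
        (\<forall>i. (LINT \<omega>|M. max 0 (\<bar>\<xi> i \<omega>\<bar> - g \<omega>)) \<le> \<epsilon>)"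
      using assms(6)
    proof
      assume "\<exists>k. AE \<omega> in M. \<xi> k \<omega> \<noteq> 0"
      then obtain k where "AE \<omega> in M. \<xi> k \<omega> \<noteq> 0" ..
      then show ?thesis
        using \<open>0 < \<epsilon>\<close> by (rule swap_invariant_excess[OF assms(2)])
    next
      assume "uniformly_integrable M \<xi>"
      then show ?thesis
        using \<open>0 < \<epsilon>\<close> by (rule uniformly_integrable_excess[OF assms(1) int])
    qed
    then obtain g where g: "integrable M g" "\<And>\<omega>. 0 \<le> g \<omega>"
      and le: "\<And>i. (LINT \<omega>|M. max 0 (\<bar>\<xi> i \<omega>\<bar> - g \<omega>)) \<le> \<epsilon>"
      by blast
    \<comment> \<open>The function \<open>g\<close> found for the single variables serves all
      averages at once, with the same \<open>\<epsilon>\<close>.\<close>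
    show "\<exists>g. integrable M g \<and> (\<forall>\<omega>. 0 \<le> g \<omega>) \<and>
        (\<forall>n. (LINT \<omega>|M. max 0 (\<bar>(\<Sum>i<n. \<xi> i \<omega>) / real n\<bar> - g \<omega>)) \<le> \<epsilon>)"
      using g average_excess_le[OF int g le] \<open>0 < \<epsilon>\<close> by (intro exI[of _ g]) simp
  qed (use int assms(4,5) in auto)
qed

end
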